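(* Let $\{X_n\}_{n\ge 0}$ be a finite irreducible discrete time Markov chain with state space $\mathcal S=\{1,\dots,m\}$, transition matrix $P$ and stationary probability vector $\boldsymbol\pi=(\pi_1,\dots,\pi_m)^T$. Let $\mathbf f(s)=(f_1(s),\dots,f_m(s))^T$ and $\mathbf g(s)=(g_1(s),\dots,g_m(s))^T$, where $f_i(s)=\sum_{n=0}^\infty P\{T_i^{(0)}=n\mid X_0=i\}s^n$ and $g_i(s)=\sum_{n=0}^\infty P\{T_i^{(1)}=n\mid X_0=i\}s^n$ are the probability generating functions of the mixing times. Then for $|s|<1$, $$\mathbf f(s)=\mathbf P(s)[\mathbf P_d(s)]^{-1}\boldsymbol\pi,\qquad \mathbf g(s)=[\mathbf P(s)-I][\mathbf P_d(s)]^{-1}\boldsymbol\pi.$$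
   Context: The mixing variable $M$ is a random variable, independent of the chain, with $P[M=j]=\pi_j$ for all $j\in\mathcal S$. Given $X_0=i$, $T_i^{(0)}=\min\{n\ge 0: X_n=M\}$ and $T_i^{(1)}=\min\{n\ge 1: X_n=M\}$. $\mathbf P(s)=\sum_{n=0}^\infty P^ns^n=[I-Ps]^{-1}$ for $|s|<1$ is the matrix generating function of the $n$-step transition probabilities, $\mathbf P_d(s)$ is the diagonal matrix with the same diagonal entries as $\mathbf P(s)$, and $I$ is the identity matrix. *)

theory Defs
  imports "HOL-Probability.Probability"
begin

definition stochastic :: "real^'n^'n \<Rightarrow> bool" where
  "stochastic P \<longleftrightarrow> (\<forall>i j. 0 \<le> P $ i $ j) \<and> (\<forall>i. (\<Sum>j\<in>UNIV. P $ i $ j) = 1)"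

primrec mat_power :: "'a::semiring_1^'n^'n \<Rightarrow> nat \<Rightarrow> 'a^'n^'n" where
  "mat_power A 0 = mat 1"
| "mat_power A (Suc n) = A ** mat_power A n"

definition irreducible_matrix :: "real^'n^'n \<Rightarrow> bool" where
  "irreducible_matrix P \<longleftrightarrow> (\<forall>i j. \<exists>n. 0 < mat_power P n $ i $ j)"

definition stationary_vector :: "real^'n^'n \<Rightarrow> real^'n \<Rightarrow> bool" where
  "stationary_vector P \<pi> \<longleftrightarrow>
     (\<forall>i. 0 \<le> \<pi> $ i) \<and> (\<Sum>i\<in>UNIV. \<pi> $ i) = 1 \<and> \<pi> v* P = \<pi>"

(* The initial law is arbitrary; the Markov property is only required for histories of
   positive probability, where the elementary conditional probability is meaningful. *)
definition markov_chain :: "'w measure \<Rightarrow> (nat \<Rightarrow> 'w \<Rightarrow> 'n::finite) \<Rightarrow> real^'n^'n \<Rightarrow> bool" where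
  "markov_chain \<Omega> X P \<longleftrightarrow>
     prob_space \<Omega> \<and>
     (\<forall>n. X n \<in> measurable \<Omega> (count_space UNIV)) \<and>
     stochastic P \<and>
     (\<forall>n x j. \<P>(\<omega> in \<Omega>. \<forall>k\<le>n. X k \<omega> = x k) > 0 \<longrightarrow>
        \<P>(\<omega> in \<Omega>. X (Suc n) \<omega> = j \<bar> \<forall>k\<le>n. X k \<omega> = x k) = P $ x n $ j)"

(* M has law \<pi>, and the sigma-algebras generated by M and by the whole trajectory (X_n)_n
   are independent (the two generators have different types, so indep_var does not apply). *)
definition mixing_variable ::
    "'w measure \<Rightarrow> (nat \<Rightarrow> 'w \<Rightarrow> 'n::finite) \<Rightarrow> ('w \<Rightarrow> 'n) \<Rightarrow> real^'n \<Rightarrow> bool" where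
  "mixing_variable \<Omega> X M \<pi> \<longleftrightarrow>
     M \<in> measurable \<Omega> (count_space UNIV) \<and>
     prob_space.indep_set \<Omega>
       (sets (vimage_algebra (space \<Omega>) M (count_space UNIV)))
       (sets (vimage_algebra (space \<Omega>) (\<lambda>\<omega> n. X n \<omega>) (Pi\<^sub>M UNIV (\<lambda>_::nat. count_space UNIV)))) \<and>
     (\<forall>j. \<P>(\<omega> in \<Omega>. M \<omega> = j) = \<pi> $ j)"

(* T^(k) = min {n >= k. X_n = M}, with value \<infinity> if M is never hit from time k on. *)
definition mixing_time :: "nat \<Rightarrow> (nat \<Rightarrow> 'w \<Rightarrow> 'n) \<Rightarrow> ('w \<Rightarrow> 'n) \<Rightarrow> 'w \<Rightarrow> enat" where
  "mixing_time k X M \<omega> = Inf (enat ` {n. k \<le> n \<and> X n \<omega> = M \<omega>})"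

(* \<Omega> i is the probability space used for conditioning on X_0 = i.  A constant family is one
   chain whose initial law charges every state; \<Omega> i may also be the law of the chain started at i. *)
definition mixing_pgf ::
    "nat \<Rightarrow> ('n \<Rightarrow> 'w measure) \<Rightarrow> (nat \<Rightarrow> 'w \<Rightarrow> 'n::finite) \<Rightarrow> ('w \<Rightarrow> 'n) \<Rightarrow> complex \<Rightarrow> complex^'n" where
  "mixing_pgf k \<Omega> X M s =
     (\<chi> i. \<Sum>n. of_real (\<P>(\<omega> in \<Omega> i. mixing_time k X M \<omega> = enat n \<bar> X 0 \<omega> = i)) * s ^ n)"

definition transition_gf :: "real^'n^'n \<Rightarrow> complex \<Rightarrow> complex^'n^'n" where
  "transition_gf P s = (\<chi> i j. \<Sum>n. of_real (mat_power P n $ i $ j) * s ^ n)"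

definition diag_part :: "'a::zero^'n^'n \<Rightarrow> 'a^'n^'n" where
  "diag_part A = (\<chi> i j. if i = j then A $ i $ j else 0)"

definition complex_vec :: "real^'n \<Rightarrow> complex^'n" where
  "complex_vec v = (\<chi> i. of_real (v $ i))"

end

theory Submission
  imports Defs
begin

text \<open>
  Decompose the event \<open>X\<^sub>n = j\<close> according to the first time \<open>m \<ge> k\<close> at which \<open>j\<close> is visited.  By the
  Markov property this gives the renewal equations
  \<open>P\<^sub>i\<^sub>j(s) = F\<^sub>i\<^sub>j(s) P\<^sub>j\<^sub>j(s)\<close> (\<open>k = 0\<close>) and \<open>P\<^sub>i\<^sub>j(s) - \<delta>\<^sub>i\<^sub>j = G\<^sub>i\<^sub>j(s) P\<^sub>j\<^sub>j(s)\<close> (\<open>k = 1\<close>).  The second one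
  with \<open>i = j\<close> forces \<open>P\<^sub>j\<^sub>j(s) \<noteq> 0\<close>, so the diagonal part is invertible, and averaging over the
  independent target \<open>M\<close> gives the formulas.
\<close>

section \<open>First visits and mixing times\<close>

text \<open>A property of a deterministic path with a fixed target, so that it applies both to a
  trajectory of the chain and to a point of the product space of paths.\<close>

definition first_visit :: "nat \<Rightarrow> 'a \<Rightarrow> nat \<Rightarrow> (nat \<Rightarrow> 'a) \<Rightarrow> bool" where
  "first_visit k j n x \<longleftrightarrow> k \<le> n \<and> x n = j \<and> (\<forall>m. k \<le> m \<and> m < n \<longrightarrow> x m \<noteq> j)"

lemma first_visit_unique:
  assumes "first_visit k j m x" "first_visit k j n x"
  shows "m = n"
  using assms unfolding first_visit_def by (metis linorder_neqE_nat)

lemma first_visit_exists: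
  assumes "k \<le> n" "x n = j"
  shows "\<exists>m\<le>n. first_visit k j m x"
proof -
  let ?m = "LEAST m. k \<le> m \<and> x m = j"
  have "k \<le> ?m \<and> x ?m = j"
    using assms by (intro LeastI[of "\<lambda>m. k \<le> m \<and> x m = j" n]) simp
  moreover have "?m \<le> n"
    using assms by (intro Least_le) simp
  ultimately show ?thesis
    unfolding first_visit_def by (metis (mono_tags, lifting) not_less_Least)
qed

text \<open>A finite value rules out the empty set of hitting times, whose infimum is \<infinity>,
  and a nonempty set of naturals attains its infimum. On \<open>M \<omega> = j\<close> the random
  target thus becomes the fixed target \<open>j\<close>.\<close>

lemma mixing_time_eq_enat_iff:
  "mixing_time k X M \<omega> = enat n \<longleftrightarrow> first_visit k (M \<omega>) n (\<lambda>n. X n \<omega>)"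
proof
  let ?A = "{n. k \<le> n \<and> X n \<omega> = M \<omega>}"
  assume eq: "mixing_time k X M \<omega> = enat n"
  then have "?A \<noteq> {}"
    unfolding mixing_time_def Inf_enat_def by (auto split: if_splits)
  then have "Inf (enat ` ?A) \<in> enat ` ?A"
    unfolding Inf_enat_def by (auto intro: LeastI)
  then have "n \<in> ?A"
    using eq unfolding mixing_time_def by auto
  moreover have "n \<le> m" if "m \<in> ?A" for m
    using eq that Inf_lower[of "enat m" "enat ` ?A"] unfolding mixing_time_def by simp
  ultimately show "first_visit k (M \<omega>) n (\<lambda>n. X n \<omega>)"
    unfolding first_visit_def by force
next
  assume "first_visit k (M \<omega>) n (\<lambda>n. X n \<omega>)"
  then show "mixing_time k X M \<omega> = enat n"
    unfolding mixing_time_def first_visit_def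
    by (intro antisym Inf_lower Inf_greatest) (auto simp: not_less[symmetric])
qed

section \<open>The Markov property for events of the past\<close>

lemma markov_chain_measurable:
  fixes X :: "nat \<Rightarrow> 'w \<Rightarrow> 'n::finite"
  assumes "markov_chain \<Omega> X P"
  shows "X n \<in> measurable \<Omega> (count_space UNIV)"
  using assms unfolding markov_chain_def by blast

text \<open>In product form the Markov property covers null histories as well, since both sides then
  vanish; histories can therefore be summed without case distinctions.\<close>

lemma markov_history_step:
  fixes X :: "nat \<Rightarrow> 'w \<Rightarrow> 'n::finite"
  assumes "markov_chain \<Omega> X P"
  shows "\<P>(\<omega> in \<Omega>. (\<forall>k\<le>n. X k \<omega> = x k) \<and> X (Suc n) \<omega> = j) =
         \<P>(\<omega> in \<Omega>. \<forall>k\<le>n. X k \<omega> = x k) * P $ x n $ j"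
proof -
  interpret prob_space \<Omega> using assms unfolding markov_chain_def by blast
  note [measurable] = markov_chain_measurable[OF assms]
  show ?thesis
  proof (cases "\<P>(\<omega> in \<Omega>. \<forall>k\<le>n. X k \<omega> = x k) > 0")
    case True
    then have "\<P>(\<omega> in \<Omega>. X (Suc n) \<omega> = j \<bar> \<forall>k\<le>n. X k \<omega> = x k) = P $ x n $ j"
      using assms unfolding markov_chain_def by blast
    with True show ?thesis
      unfolding cond_prob_def by (simp add: field_simps conj_commute)
  next
    case False
    then have "\<P>(\<omega> in \<Omega>. \<forall>k\<le>n. X k \<omega> = x k) = 0"
      using measure_nonneg[of \<Omega>] by (simp add: order.not_eq_order_implies_strict not_less antisym)
    moreover have "\<P>(\<omega> in \<Omega>. (\<forall>k\<le>n. X k \<omega> = x k) \<and> X (Suc n) \<omega> = j) \<le>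
        \<P>(\<omega> in \<Omega>. \<forall>k\<le>n. X k \<omega> = x k)"
      by (intro finite_measure_mono) auto
    ultimately show ?thesis
      using measure_nonneg by (simp add: antisym)
  qed
qed

text \<open>Elementary substitute for membership in the sigma-algebra of
  \<open>X 0, ..., X n\<close>: over a finite state space such an event is a finite union of
  histories.\<close>

definition determined_up_to :: "nat \<Rightarrow> ((nat \<Rightarrow> 'a) \<Rightarrow> bool) \<Rightarrow> bool" where
  "determined_up_to n Q \<longleftrightarrow> (\<forall>x y. (\<forall>k\<le>n. x k = y k) \<longrightarrow> Q x = Q y)"

text \<open>Histories are taken extensional on \<open>{..n}\<close>: this makes them finitely many,
  and distinct ones describe disjoint events.\<close>

lemma determined_up_to_decomp:
  assumes "determined_up_to n Q"
  shows "Q x \<longleftrightarrow> (\<exists>h\<in>{h \<in> {..n} \<rightarrow>\<^sub>E UNIV. Q h}. \<forall>k\<le>n. x k = h k)"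
proof
  assume "Q x"
  moreover from this have "Q (restrict x {..n})"
    using assms unfolding determined_up_to_def by (metis (no_types, lifting) atMost_iff restrict_apply')
  ultimately show "\<exists>h\<in>{h \<in> {..n} \<rightarrow>\<^sub>E UNIV. Q h}. \<forall>k\<le>n. x k = h k"
    by (intro bexI[of _ "restrict x {..n}"]) auto
next
  assume "\<exists>h\<in>{h \<in> {..n} \<rightarrow>\<^sub>E UNIV. Q h}. \<forall>k\<le>n. x k = h k"
  then show "Q x"
    using assms unfolding determined_up_to_def by blast
qed

lemma prob_determined_up_to:
  fixes X :: "nat \<Rightarrow> 'w \<Rightarrow> 'n::finite"
  assumes mc: "markov_chain \<Omega> X P" and Q: "determined_up_to n Q"
    and [measurable]: "Measurable.pred \<Omega> R"
  shows "\<P>(\<omega> in \<Omega>. Q (\<lambda>k. X k \<omega>) \<and> R \<omega>) =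
    (\<Sum>h\<in>{h \<in> {..n} \<rightarrow>\<^sub>E UNIV. Q h}. \<P>(\<omega> in \<Omega>. (\<forall>k\<le>n. X k \<omega> = h k) \<and> R \<omega>))"
proof -
  interpret prob_space \<Omega> using mc unfolding markov_chain_def by blast
  note [measurable] = markov_chain_measurable[OF mc]
  let ?H = "{h \<in> {..n} \<rightarrow>\<^sub>E (UNIV :: 'n set). Q h}"
  have fin: "finite ?H"
    by (rule finite_subset[of _ "{..n} \<rightarrow>\<^sub>E UNIV"]) (auto intro: finite_PiE)
  have dec: "Q (\<lambda>k. X k \<omega>) \<longleftrightarrow> (\<exists>h\<in>?H. \<forall>k\<le>n. X k \<omega> = h k)" for \<omega>
    by (rule determined_up_to_decomp[OF Q])
  have "{\<omega> \<in> space \<Omega>. Q (\<lambda>k. X k \<omega>) \<and> R \<omega>} =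
      (\<Union>h\<in>?H. {\<omega> \<in> space \<Omega>. (\<forall>k\<le>n. X k \<omega> = h k) \<and> R \<omega>})"
    unfolding dec by blast
  moreover have "disjoint_family_on (\<lambda>h. {\<omega> \<in> space \<Omega>. (\<forall>k\<le>n. X k \<omega> = h k) \<and> R \<omega>}) ?H"
    unfolding disjoint_family_on_def
  proof (intro ballI impI equals0I)
    fix h h' \<omega> assume "h \<in> ?H" "h' \<in> ?H" "h \<noteq> h'"
      "\<omega> \<in> {\<omega> \<in> space \<Omega>. (\<forall>k\<le>n. X k \<omega> = h k) \<and> R \<omega>} \<inter>
        {\<omega> \<in> space \<Omega>. (\<forall>k\<le>n. X k \<omega> = h' k) \<and> R \<omega>}"
    moreover from this have "h k = h' k" if "k \<in> {..n}" for k
      using that by simp metis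
    ultimately show False
      using PiE_ext[of h "{..n}" "\<lambda>_. UNIV" h'] by blast
  qed
  ultimately show ?thesis
    by (simp only:) (rule finite_measure_finite_Union[OF fin]; auto)
qed

lemma determined_up_to_measurable:
  fixes X :: "nat \<Rightarrow> 'w \<Rightarrow> 'n::finite"
  assumes mc: "markov_chain \<Omega> X P" and Q: "determined_up_to n Q"
  shows "Measurable.pred \<Omega> (\<lambda>\<omega>. Q (\<lambda>k. X k \<omega>))"
proof -
  note [measurable] = markov_chain_measurable[OF mc]
  have "finite {h \<in> {..n} \<rightarrow>\<^sub>E (UNIV :: 'n set). Q h}"
    by (rule finite_subset[of _ "{..n} \<rightarrow>\<^sub>E UNIV"]) (auto intro: finite_PiE)
  then show ?thesis
    by (subst determined_up_to_decomp[OF Q]) measurable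
qed

text \<open>Sum the one-step identity over the histories that satisfy \<open>Q\<close>. All of them
  end in \<open>l\<close>, so the transition probability is a common factor.\<close>

lemma markov_step:
  fixes X :: "nat \<Rightarrow> 'w \<Rightarrow> 'n::finite"
  assumes mc: "markov_chain \<Omega> X P" and Q: "determined_up_to n Q"
    and l: "\<And>x. Q x \<Longrightarrow> x n = l"
  shows "\<P>(\<omega> in \<Omega>. Q (\<lambda>k. X k \<omega>) \<and> X (Suc n) \<omega> = j) = \<P>(\<omega> in \<Omega>. Q (\<lambda>k. X k \<omega>)) * P $ l $ j"
proof -
  note [measurable] = markov_chain_measurable[OF mc]
  show ?thesis
    using prob_determined_up_to[OF mc Q, of "\<lambda>_. True"]
      prob_determined_up_to[OF mc Q, of "\<lambda>\<omega>. X (Suc n) \<omega> = j"]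
    by (simp add: markov_history_step[OF mc] l sum_distrib_right)
qed

text \<open>Induction on \<open>m\<close> with \<open>Q\<close> general: the state at time
  \<open>Suc n\<close> is absorbed into the past event, and summing over it produces the matrix
  product.\<close>

lemma markov_steps:
  fixes X :: "nat \<Rightarrow> 'w \<Rightarrow> 'n::finite"
  assumes mc: "markov_chain \<Omega> X P" and Q: "determined_up_to n Q"
    and l: "\<And>x. Q x \<Longrightarrow> x n = l"
  shows "\<P>(\<omega> in \<Omega>. Q (\<lambda>k. X k \<omega>) \<and> X (n + m) \<omega> = j) =
         \<P>(\<omega> in \<Omega>. Q (\<lambda>k. X k \<omega>)) * mat_power P m $ l $ j"
  using Q l
proof (induction m arbitrary: n Q l)
  case 0
  have "{\<omega> \<in> space \<Omega>. Q (\<lambda>k. X k \<omega>) \<and> X n \<omega> = j} =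
      (if l = j then {\<omega> \<in> space \<Omega>. Q (\<lambda>k. X k \<omega>)} else {})"
    using 0(2) by auto
  then show ?case by (simp add: mat_def)
next
  case (Suc m)
  interpret prob_space \<Omega> using mc unfolding markov_chain_def by blast
  note [measurable] = markov_chain_measurable[OF mc] determined_up_to_measurable[OF mc Suc.prems(1)]
  let ?Q = "\<lambda>l' x. Q x \<and> x (Suc n) = l'"
  have det: "determined_up_to (Suc n) (?Q l')" for l'
    using Suc.prems(1) unfolding determined_up_to_def by (metis le_Suc_eq)
  have "{\<omega> \<in> space \<Omega>. Q (\<lambda>k. X k \<omega>) \<and> X (n + Suc m) \<omega> = j} =
      (\<Union>l'. {\<omega> \<in> space \<Omega>. ?Q l' (\<lambda>k. X k \<omega>) \<and> X (Suc n + m) \<omega> = j})"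
    by auto
  then have "\<P>(\<omega> in \<Omega>. Q (\<lambda>k. X k \<omega>) \<and> X (n + Suc m) \<omega> = j) =
      (\<Sum>l'\<in>UNIV. \<P>(\<omega> in \<Omega>. ?Q l' (\<lambda>k. X k \<omega>) \<and> X (Suc n + m) \<omega> = j))"
    by (simp only:) (rule finite_measure_finite_Union; auto simp: disjoint_family_on_def)
  also have "\<dots> = (\<Sum>l'\<in>UNIV. \<P>(\<omega> in \<Omega>. Q (\<lambda>k. X k \<omega>)) * P $ l $ l' * mat_power P m $ l' $ j)"
    using Suc.IH[OF det] markov_step[OF mc Suc.prems(1), of l] Suc.prems(2)
    by (intro sum.cong) auto
  finally show ?case
    by (simp add: matrix_matrix_mult_def sum_distrib_left mult.assoc)
qed

text \<open>The case of the past event \<open>X 0 = i\<close>. Besides its use in the renewal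
  equation, it bounds the entries of the matrix powers by 1.\<close>

lemma mat_power_eq_cond_prob:
  fixes X :: "nat \<Rightarrow> 'w \<Rightarrow> 'n::finite"
  assumes "markov_chain \<Omega> X P" and "\<P>(\<omega> in \<Omega>. X 0 \<omega> = i) > 0"
  shows "\<P>(\<omega> in \<Omega>. X n \<omega> = j \<bar> X 0 \<omega> = i) = mat_power P n $ i $ j"
proof -
  have "determined_up_to 0 (\<lambda>x. x 0 = i)"
    unfolding determined_up_to_def by simp
  from markov_steps[OF assms(1) this, of i n j]
  have "\<P>(\<omega> in \<Omega>. X n \<omega> = j \<and> X 0 \<omega> = i) = \<P>(\<omega> in \<Omega>. X 0 \<omega> = i) * mat_power P n $ i $ j"
    by (simp add: conj_commute)
  then show ?thesis
    using assms(2) by (simp add: cond_prob_def)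
qed

section \<open>Power series with coefficients bounded by 1\<close>

text \<open>If the conditioning event is null, the quotient is 0 by the convention for division by
  zero, so the bound persists.\<close>

lemma (in prob_space) norm_cond_prob_le_1:
  assumes "{x \<in> space M. B x} \<in> events"
  shows "norm (of_real \<P>(x in M. A x \<bar> B x) :: complex) \<le> 1"
proof -
  have "\<P>(x in M. A x \<and> B x) \<le> \<P>(x in M. B x)"
    using assms by (intro finite_measure_mono) auto
  then show ?thesis
    by (simp add: cond_prob_def norm_divide divide_le_eq_1 less_le)
qed

lemma summable_bounded_coeffs:
  fixes a :: "nat \<Rightarrow> complex"
  assumes "norm s < 1" and "\<And>n. norm (a n) \<le> 1"
  shows "summable (\<lambda>n. norm (a n * s ^ n))"
proof (rule summable_comparison_test')
  show "summable (\<lambda>n. norm s ^ n)" using assms by (simp add: summable_geometric)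
  show "norm (norm (a n * s ^ n)) \<le> norm s ^ n" if "n \<ge> 0" for n
    using mult_right_mono[OF assms(2)[of n], of "norm s ^ n"] by (simp add: norm_mult norm_power)
qed

text \<open>Cauchy product; both series converge absolutely by comparison with the geometric
  series.\<close>

lemma gf_convolution:
  fixes a b :: "nat \<Rightarrow> complex"
  assumes "norm s < 1" and "\<And>n. norm (a n) \<le> 1" and "\<And>n. norm (b n) \<le> 1"
  shows "(\<Sum>n. a n * s ^ n) * (\<Sum>n. b n * s ^ n) = (\<Sum>n. (\<Sum>m\<le>n. a m * b (n - m)) * s ^ n)"
proof -
  have "(\<Sum>m\<le>n. a m * s ^ m * (b (n - m) * s ^ (n - m))) = (\<Sum>m\<le>n. a m * b (n - m)) * s ^ n" for n
    unfolding sum_distrib_right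
    by (intro sum.cong) (auto simp: mult_ac simp flip: power_add)
  then show ?thesis
    using assms by (subst Cauchy_product) (auto intro: summable_bounded_coeffs)
qed

section \<open>Renewal equations and their generating functions\<close>

definition first_visit_prob :: "nat \<Rightarrow> 'w measure \<Rightarrow> (nat \<Rightarrow> 'w \<Rightarrow> 'n) \<Rightarrow> 'n \<Rightarrow> 'n \<Rightarrow> nat \<Rightarrow> real" where
  "first_visit_prob k \<Omega> X i j n = \<P>(\<omega> in \<Omega>. first_visit k j n (\<lambda>n. X n \<omega>) \<bar> X 0 \<omega> = i)"

lemma determined_up_to_first_visit: "determined_up_to n (first_visit k j n)"
  unfolding determined_up_to_def first_visit_def by (metis le_refl less_imp_le)

text \<open>If \<open>X n = j\<close> and \<open>k \<le> n\<close>, exactly one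
  \<open>m \<le> n\<close> is the time of the first visit to \<open>j\<close> from time
  \<open>k\<close> on, and from \<open>m\<close> on the chain restarts in \<open>j\<close>. For
  \<open>n < k\<close> no such visit is possible and every term is 0.\<close>

lemma renewal:
  fixes X :: "nat \<Rightarrow> 'w \<Rightarrow> 'n::finite"
  assumes mc: "markov_chain \<Omega> X P" and pos: "\<P>(\<omega> in \<Omega>. X 0 \<omega> = i) > 0"
  shows "(\<Sum>m\<le>n. first_visit_prob k \<Omega> X i j m * mat_power P (n - m) $ j $ j) =
         (if k \<le> n then mat_power P n $ i $ j else 0)"
proof (cases "k \<le> n")
  case False
  then show ?thesis
    by (simp add: first_visit_prob_def first_visit_def cond_prob_def)
next
  case True
  interpret prob_space \<Omega> using mc unfolding markov_chain_def by blast
  note [measurable] = markov_chain_measurable[OF mc]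
    determined_up_to_measurable[OF mc determined_up_to_first_visit]
  \<comment> \<open>The initial condition joins the past event, so \<open>markov_steps\<close>
    applies to unconditional probabilities; division by the probability of \<open>X 0 = i\<close>
    comes last.\<close>
  let ?Q = "\<lambda>m x. first_visit k j m x \<and> x 0 = i"
  have det: "determined_up_to m (?Q m)" for m
    using determined_up_to_first_visit[of m k j] unfolding determined_up_to_def
    by (metis le0)
  have "{\<omega> \<in> space \<Omega>. X n \<omega> = j \<and> X 0 \<omega> = i} =
      (\<Union>m\<in>{..n}. {\<omega> \<in> space \<Omega>. ?Q m (\<lambda>k. X k \<omega>) \<and> X (m + (n - m)) \<omega> = j})"
    using first_visit_exists[OF True] by fastforce
  then have "\<P>(\<omega> in \<Omega>. X n \<omega> = j \<and> X 0 \<omega> = i) =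
      (\<Sum>m\<le>n. \<P>(\<omega> in \<Omega>. ?Q m (\<lambda>k. X k \<omega>) \<and> X (m + (n - m)) \<omega> = j))"
    by (simp only:)
      (rule finite_measure_finite_Union; auto simp: disjoint_family_on_def dest: first_visit_unique)
  also have "\<dots> = (\<Sum>m\<le>n. \<P>(\<omega> in \<Omega>. ?Q m (\<lambda>k. X k \<omega>)) * mat_power P (n - m) $ j $ j)"
    by (intro sum.cong markov_steps[OF mc det]) (auto simp: first_visit_def)
  finally show ?thesis
    using True mat_power_eq_cond_prob[OF mc pos, of n j]
    by (simp add: first_visit_prob_def cond_prob_def sum_divide_distrib)
qed

lemma norm_first_visit_prob_le_1:
  fixes X :: "nat \<Rightarrow> 'w \<Rightarrow> 'n::finite"
  assumes mc: "markov_chain \<Omega> X P"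
  shows "norm (of_real (first_visit_prob k \<Omega> X i j n) :: complex) \<le> 1"
proof -
  interpret prob_space \<Omega> using mc unfolding markov_chain_def by blast
  note [measurable] = markov_chain_measurable[OF mc]
  show ?thesis
    unfolding first_visit_prob_def by (rule norm_cond_prob_le_1) measurable
qed

lemma norm_mat_power_le_1:
  fixes X :: "nat \<Rightarrow> 'w \<Rightarrow> 'n::finite"
  assumes mc: "markov_chain \<Omega> X P" and pos: "\<P>(\<omega> in \<Omega>. X 0 \<omega> = i) > 0"
  shows "norm (of_real (mat_power P n $ i $ j) :: complex) \<le> 1"
proof -
  interpret prob_space \<Omega> using mc unfolding markov_chain_def by blast
  note [measurable] = markov_chain_measurable[OF mc]
  show ?thesis
    unfolding mat_power_eq_cond_prob[OF mc pos, symmetric] by (rule norm_cond_prob_le_1) measurable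
qed

text \<open>The renewal equation read as a product of power series. A chain charging
  \<open>i\<close> supplies the renewal equation, one charging \<open>j\<close> the bound on the
  coefficients of the second factor.\<close>

lemma first_visit_gf:
  fixes \<Omega> :: "'n::finite \<Rightarrow> 'w measure" and s :: complex
  assumes mc: "\<And>i. markov_chain (\<Omega> i) X P"
    and pos: "\<And>i. \<P>(\<omega> in \<Omega> i. X 0 \<omega> = i) > 0"
    and s: "norm s < 1"
  shows "(\<Sum>n. of_real (first_visit_prob k (\<Omega> i) X i j n) * s ^ n) * transition_gf P s $ j $ j =
         (\<Sum>n. if k \<le> n then of_real (mat_power P n $ i $ j) * s ^ n else 0)"
proof -
  have "(\<Sum>n. of_real (first_visit_prob k (\<Omega> i) X i j n) * s ^ n) * transition_gf P s $ j $ j =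
      (\<Sum>n. (\<Sum>m\<le>n. of_real (first_visit_prob k (\<Omega> i) X i j m) *
        of_real (mat_power P (n - m) $ j $ j)) * s ^ n)"
    unfolding transition_gf_def
    by (simp add: gf_convolution[OF s norm_first_visit_prob_le_1[OF mc] norm_mat_power_le_1[OF mc pos]])
  also have "\<dots> = (\<Sum>n. of_real (if k \<le> n then mat_power P n $ i $ j else 0) * s ^ n)"
    by (simp flip: of_real_mult of_real_sum add: renewal[OF mc pos])
  also have "\<dots> = (\<Sum>n. if k \<le> n then of_real (mat_power P n $ i $ j) * s ^ n else 0)"
    by (rule suminf_cong) simp
  finally show ?thesis .
qed

lemma transition_gf_minus_one:
  fixes X :: "nat \<Rightarrow> 'w \<Rightarrow> 'n::finite" and s :: complex
  assumes mc: "markov_chain \<Omega> X P" and pos: "\<P>(\<omega> in \<Omega>. X 0 \<omega> = i) > 0"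
    and s: "norm s < 1"
  shows "(\<Sum>n. if 1 \<le> n then of_real (mat_power P n $ i $ j) * s ^ n else 0) =
         (transition_gf P s - mat 1) $ i $ j"
proof -
  let ?p = "\<lambda>n. of_real (mat_power P n $ i $ j) * s ^ n"
  have p: "summable ?p"
    by (rule summable_norm_cancel[OF summable_bounded_coeffs[OF s norm_mat_power_le_1[OF mc pos]]])
  have "summable (\<lambda>n. if 1 \<le> n then ?p n else 0)"
    by (rule summable_comparison_test'[of "\<lambda>n. norm (?p n)"])
      (use summable_bounded_coeffs[OF s norm_mat_power_le_1[OF mc pos]] in auto)
  \<comment> \<open>Both series have the same terms from index 1 on. Their heads are 0 and the entry
    of the identity matrix.\<close>
  from suminf_split_head[OF this] suminf_split_head[OF p] show ?thesis
    by (simp add: transition_gf_def mat_def)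
qed

lemma transition_gf_diag_nonzero:
  fixes \<Omega> :: "'n::finite \<Rightarrow> 'w measure" and s :: complex
  assumes "\<And>i. markov_chain (\<Omega> i) X P"
    and "\<And>i. \<P>(\<omega> in \<Omega> i. X 0 \<omega> = i) > 0"
    and "norm s < 1"
  shows "transition_gf P s $ j $ j \<noteq> 0"
proof
  assume zero: "transition_gf P s $ j $ j = 0"
  have "(transition_gf P s - mat 1) $ j $ j =
      (\<Sum>n. if 1 \<le> n then of_real (mat_power P n $ j $ j) * s ^ n else 0)"
    using transition_gf_minus_one[of "\<Omega> j" X P j s j, OF assms(1) assms(2) assms(3)] by (rule sym)
  also have "\<dots> = (\<Sum>n. of_real (first_visit_prob 1 (\<Omega> j) X j j n) * s ^ n) * transition_gf P s $ j $ j"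
    using first_visit_gf[of \<Omega> X P s 1 j j, OF assms] by (rule sym)
  also have "\<dots> = 0"
    unfolding zero by (rule mult_zero_right)
  \<comment> \<open>Under \<open>zero\<close> the left-hand side is 0 - 1, a contradiction.\<close>
  finally show False
    using zero by (simp add: mat_def)
qed

section \<open>Averaging over the mixing variable\<close>

text \<open>Split by the value \<open>j\<close> of \<open>M\<close>; independence of
  \<open>M\<close> from the whole trajectory pulls out the weight \<open>\<pi> $ j\<close>.\<close>

lemma mixing_time_prob:
  fixes X :: "nat \<Rightarrow> 'w \<Rightarrow> 'n::finite"
  assumes mc: "markov_chain \<Omega> X P" and mix: "mixing_variable \<Omega> X M \<pi>"
  shows "\<P>(\<omega> in \<Omega>. mixing_time k X M \<omega> = enat n \<bar> X 0 \<omega> = i) =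
         (\<Sum>j\<in>UNIV. \<pi> $ j * first_visit_prob k \<Omega> X i j n)"
proof -
  interpret prob_space \<Omega> using mc unfolding markov_chain_def by blast
  have [measurable]: "M \<in> measurable \<Omega> (count_space UNIV)"
    and indep: "indep_set (sets (vimage_algebra (space \<Omega>) M (count_space UNIV)))
       (sets (vimage_algebra (space \<Omega>) (\<lambda>\<omega> n. X n \<omega>) (Pi\<^sub>M UNIV (\<lambda>_::nat. count_space UNIV))))"
    and law: "\<P>(\<omega> in \<Omega>. M \<omega> = j) = \<pi> $ j" for j
    using mix unfolding mixing_variable_def by blast+
  note [measurable] = markov_chain_measurable[OF mc]
    determined_up_to_measurable[OF mc determined_up_to_first_visit]
  \<comment> \<open>\<open>X 0 = i\<close> is part of the trajectory event, so a single use of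
    independence also handles the conditioning.\<close>
  let ?E = "\<lambda>j \<omega>. first_visit k j n (\<lambda>n. X n \<omega>) \<and> X 0 \<omega> = i"
  have prod: "\<P>(\<omega> in \<Omega>. M \<omega> = j \<and> ?E j \<omega>) = \<pi> $ j * \<P>(\<omega> in \<Omega>. ?E j \<omega>)" for j
  proof -
    have "{\<omega> \<in> space \<Omega>. M \<omega> = j} \<in> sets (vimage_algebra (space \<Omega>) M (count_space UNIV))"
      using in_vimage_algebra[of "{j}" "count_space UNIV" M "space \<Omega>"]
      by (simp add: vimage_def Int_def conj_commute)
    moreover have "{x :: nat \<Rightarrow> 'n. first_visit k j n x \<and> x 0 = i} \<in> sets (Pi\<^sub>M UNIV (\<lambda>_. count_space UNIV))"
      (is "?A \<in> sets ?S")
    proof -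
      have "{x \<in> space ?S. first_visit k j n x \<and> x 0 = i} \<in> sets ?S"
        unfolding first_visit_def by measurable
      then show ?thesis by (simp add: space_PiM)
    qed
    then have "{\<omega> \<in> space \<Omega>. ?E j \<omega>} \<in>
        sets (vimage_algebra (space \<Omega>) (\<lambda>\<omega> n. X n \<omega>) (Pi\<^sub>M UNIV (\<lambda>_::nat. count_space UNIV)))"
      using in_vimage_algebra[of ?A ?S "\<lambda>\<omega> n. X n \<omega>" "space \<Omega>"]
      by (simp add: vimage_def Int_def conj_commute)
    ultimately have "prob ({\<omega> \<in> space \<Omega>. M \<omega> = j} \<inter> {\<omega> \<in> space \<Omega>. ?E j \<omega>}) =
        \<P>(\<omega> in \<Omega>. M \<omega> = j) * \<P>(\<omega> in \<Omega>. ?E j \<omega>)"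
      by (rule indep_setD[OF indep])
    moreover have "{\<omega> \<in> space \<Omega>. M \<omega> = j} \<inter> {\<omega> \<in> space \<Omega>. ?E j \<omega>} =
        {\<omega> \<in> space \<Omega>. M \<omega> = j \<and> ?E j \<omega>}"
      by auto
    ultimately show ?thesis by (simp add: law)
  qed
  have "{\<omega> \<in> space \<Omega>. mixing_time k X M \<omega> = enat n \<and> X 0 \<omega> = i} =
      (\<Union>j. {\<omega> \<in> space \<Omega>. M \<omega> = j \<and> ?E j \<omega>})"
    by (auto simp: mixing_time_eq_enat_iff)
  then have "\<P>(\<omega> in \<Omega>. mixing_time k X M \<omega> = enat n \<and> X 0 \<omega> = i) =
      (\<Sum>j\<in>UNIV. \<P>(\<omega> in \<Omega>. M \<omega> = j \<and> ?E j \<omega>))"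
    by (simp only:) (rule finite_measure_finite_Union; auto simp: disjoint_family_on_def)
  then show ?thesis
    unfolding prod by (simp add: cond_prob_def first_visit_prob_def sum_divide_distrib)
qed

text \<open>The sum over targets is finite and each series converges, so the two summations may be
  exchanged.\<close>

lemma mixing_pgf_nth:
  fixes \<Omega> :: "'n::finite \<Rightarrow> 'w measure" and s :: complex
  assumes mc: "\<And>i. markov_chain (\<Omega> i) X P"
    and mix: "\<And>i. mixing_variable (\<Omega> i) X M \<pi>"
    and s: "norm s < 1"
  shows "mixing_pgf k \<Omega> X M s $ i =
         (\<Sum>j\<in>UNIV. (\<Sum>n. of_real (first_visit_prob k (\<Omega> i) X i j n) * s ^ n) * of_real (\<pi> $ j))"
proof -
  have sum: "summable (\<lambda>n. of_real (first_visit_prob k (\<Omega> i) X i j n) * s ^ n)" for j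
    by (rule summable_norm_cancel[OF summable_bounded_coeffs[OF s norm_first_visit_prob_le_1[OF mc]]])
  have "mixing_pgf k \<Omega> X M s $ i =
      (\<Sum>n. \<Sum>j\<in>UNIV. of_real (first_visit_prob k (\<Omega> i) X i j n) * s ^ n * of_real (\<pi> $ j))"
    by (simp add: mixing_pgf_def mixing_time_prob[OF mc mix] sum_distrib_left mult_ac)
  also have "\<dots> =
      (\<Sum>j\<in>UNIV. \<Sum>n. of_real (first_visit_prob k (\<Omega> i) X i j n) * s ^ n * of_real (\<pi> $ j))"
    by (intro suminf_sum summable_mult2 sum)
  finally show ?thesis
    by (simp add: suminf_mult2[OF sum])
qed

section \<open>Inverting the diagonal part\<close>

text \<open>\<open>matrix_inv\<close> chooses some two-sided inverse. The explicit matrix shows that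
  one exists, and associativity shows that the chosen one equals it.\<close>

lemma matrix_inv_diag_part:
  fixes A :: "'a::field^'n^'n"
  assumes "\<And>j. A $ j $ j \<noteq> 0"
  shows "matrix_inv (diag_part A) = (\<chi> i j. if i = j then inverse (A $ j $ j) else 0)"
    (is "_ = ?B")
proof -
  have AB: "diag_part A ** ?B = mat 1" and BA: "?B ** diag_part A = mat 1"
    by (simp_all add: vec_eq_iff matrix_matrix_mult_def diag_part_def mat_def mult_delta_left
        mult_delta_right assms)
  have right: "diag_part A ** matrix_inv (diag_part A) = mat 1"
    unfolding matrix_inv_def by (rule someI2[where a = ?B]) (use AB BA in auto)
  have "matrix_inv (diag_part A) = ?B ** diag_part A ** matrix_inv (diag_part A)"
    unfolding BA by (rule matrix_mul_lid[symmetric])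
  also have "\<dots> = ?B ** (diag_part A ** matrix_inv (diag_part A))"
    by (rule matrix_mul_assoc[symmetric])
  also have "\<dots> = ?B"
    unfolding right by (rule matrix_mul_rid)
  finally show ?thesis .
qed

lemma mult_matrix_inv_diag_part_nth:
  fixes A :: "'a::field^'n^'n"
  assumes "\<And>j. A $ j $ j \<noteq> 0"
  shows "(B ** matrix_inv (diag_part A) *v v) $ i = (\<Sum>j\<in>UNIV. B $ i $ j / A $ j $ j * v $ j)"
  unfolding matrix_inv_diag_part[OF assms]
  by (simp add: matrix_matrix_mult_def matrix_vector_mult_def mult_delta_right divide_inverse)

theorem theorem2p5:
  fixes \<Omega> :: "'n::finite \<Rightarrow> 'w measure"
    and X :: "nat \<Rightarrow> 'w \<Rightarrow> 'n"
    and M :: "'w \<Rightarrow> 'n"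
    and P :: "real^'n^'n"
    and \<pi> :: "real^'n"
    and s :: complex
  assumes "irreducible_matrix P"
    and "stationary_vector P \<pi>"
    and "\<And>i. markov_chain (\<Omega> i) X P"
    and "\<And>i. mixing_variable (\<Omega> i) X M \<pi>"
    and "\<And>i. \<P>(\<omega> in \<Omega> i. X 0 \<omega> = i) > 0"
    and "norm s < 1"
  shows "mixing_pgf 0 \<Omega> X M s =
           transition_gf P s ** matrix_inv (diag_part (transition_gf P s)) *v complex_vec \<pi>
         \<and> mixing_pgf 1 \<Omega> X M s =
           (transition_gf P s - mat 1) ** matrix_inv (diag_part (transition_gf P s)) *v complex_vec \<pi>"
proof -
  note diag = transition_gf_diag_nonzero[where \<Omega> = \<Omega> and X = X and P = P, OF assms(3,5,6)]
  \<comment> \<open>The renewal equation solved for the first-visit series, possible because the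
    diagonal entries do not vanish.\<close>
  have gf: "(\<Sum>n. of_real (first_visit_prob k (\<Omega> i) X i j n) * s ^ n) =
      (\<Sum>n. if k \<le> n then of_real (mat_power P n $ i $ j) * s ^ n else 0) / transition_gf P s $ j $ j"
    for k i j
    using first_visit_gf[where \<Omega> = \<Omega> and X = X and P = P, OF assms(3,5,6), of k i j] diag[of j] by (simp add: field_simps)
  note nth = vec_eq_iff mixing_pgf_nth[where \<Omega> = \<Omega> and X = X and P = P, OF assms(3,4,6)] mult_matrix_inv_diag_part_nth[OF diag]
    complex_vec_def gf
  have "mixing_pgf 0 \<Omega> X M s =
      transition_gf P s ** matrix_inv (diag_part (transition_gf P s)) *v complex_vec \<pi>"
    \<comment> \<open>For \<open>k = 0\<close> the condition \<open>k \<le> n\<close> always holds,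
      so the numerator is the full entry of \<open>transition_gf P s\<close>; for
      \<open>k = 1\<close> below, the identity is subtracted.\<close>
    unfolding nth by (simp add: transition_gf_def)
  moreover have "mixing_pgf 1 \<Omega> X M s =
      (transition_gf P s - mat 1) ** matrix_inv (diag_part (transition_gf P s)) *v complex_vec \<pi>"
    unfolding nth transition_gf_minus_one[OF assms(3,5,6)] by simp
  ultimately show ?thesis by blast
qed

end
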